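(* Let $g(t)=e^{-1/t}$ for $t\in\mathbb{R}\setminus\{0\}$. For every $i\in\mathbb{N}$ and every real $t\ne 0$, $$g^{(i)}(t)=\frac{1}{e^{1/t}t^{2i}}\sum_{k=0}^{i-1}(-1)^k a_{i,k}t^{k},$$ where $$a_{i,k}=\binom{i}{k}\binom{i-1}{k}k!$$ for all $0\le k\le i-1$.
   Context: $\mathbb{N}$ denotes the set of positive integers, and $g^{(i)}$ denotes the $i$-th derivative of $g$. *)

theory Defs
  imports "HOL-Analysis.Analysis"
begin

definition a_coeff :: "nat \<Rightarrow> nat \<Rightarrow> nat" where
  "a_coeff i k = (i choose k) * ((i - 1) choose k) * fact k"

end

theory Submission
  imports Defs
begin

text \<open>
  Write \<open>P\<^sub>i(t) = \<Sum>\<^sub>k (-1)\<^sup>k a\<^sub>i\<^sub>,\<^sub>k t\<^sup>k\<close> and \<open>F\<^sub>i(t) = e\<^bsup>-1/t\<^esup> t\<^bsup>-2i\<^esup> P\<^sub>i(t)\<close>. For \<open>t \<noteq> 0\<close>,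
  the product rule gives
  \<open>F\<^sub>i'(t) = e\<^bsup>-1/t\<^esup> t\<^bsup>-2(i+1)\<^esup> (P\<^sub>i(t) - 2 i t P\<^sub>i(t) + t\<^sup>2 P\<^sub>i'(t))\<close>, and comparison of
  coefficients shows that the last factor is \<open>P\<^sub>i\<^sub>+\<^sub>1(t)\<close> for all \<open>t\<close> exactly when, for all \<open>k\<close>,
  \<open>a\<^bsub>i+1,k+1\<^esub> = a\<^bsub>i,k+1\<^esub> + (2i - k) a\<^bsub>i,k\<^esub>\<close> and \<open>a\<^bsub>i+1,0\<^esub> = a\<^bsub>i,0\<^esub>\<close>. This recurrence
  (lemma \<open>a_coeff_Suc_Suc\<close>) follows from Pascal's rule and the absorption identities for binomial
  coefficients. Since \<open>F\<^sub>0(t) = e\<^bsup>-1/t\<^esup>\<close>, induction on \<open>i\<close> shows that \<open>F\<^sub>i\<close> is the \<open>i\<close>-th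
  derivative on the open set \<open>t \<noteq> 0\<close>.
\<close>

lemma a_coeff_0_right [simp]: "a_coeff i 0 = 1"
  by (simp add: a_coeff_def)

lemma a_coeff_eq_0: "k > i \<Longrightarrow> a_coeff i k = 0"
  by (simp add: a_coeff_def)

lemma a_coeff_Suc_Suc:
  "real (a_coeff (Suc i) (Suc k)) =
     real (a_coeff i (Suc k)) + (2 * real i - real k) * real (a_coeff i k)"
proof (cases i)
  case 0
  then show ?thesis by (cases k) (simp_all add: a_coeff_def)
next
  case (Suc n)
  define x y z where "x = real (n choose k)" and "y = real (n choose Suc k)"
    and "z = real (Suc n choose k)"
  have absorb1: "(real k + 1) * (x + y) = (real n + 1) * x"
    using arg_cong[OF Suc_times_binomial_eq[of n k], of real]
    by (simp add: x_def y_def algebra_simps)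
  have absorb2: "(real n + 1 - real k) * z = (real n + 1) * x"
  proof (cases "k \<le> Suc n")
    case True
    have "real (Suc n - k) * real (Suc n choose k) = real (Suc n) * real (n choose k)"
      using binomial_absorb_comp[of "Suc n" k] by (simp only: of_nat_mult[symmetric] diff_Suc_1)
    then show ?thesis
      using True by (simp add: x_def z_def of_nat_diff add_ac)
  next
    case False
    then have "Suc n choose k = 0" "n choose k = 0"
      by (auto intro!: binomial_eq_0)
    then show ?thesis by (simp only: x_def z_def of_nat_0 mult_zero_right)
  qed
  \<comment> \<open>By Pascal's rule, \<open>x + y\<close> is \<open>n + 1\<close> choose \<open>k + 1\<close> and \<open>z + x + y\<close> is \<open>n + 2\<close> choose
      \<open>k + 1\<close>, so the outer terms of this chain are the two sides of the claim divided by \<open>k!\<close>.\<close>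
  have "(z + x + y) * (x + y) * (real k + 1)
      = (x + y) * y * (real k + 1) + (z + x) * ((real k + 1) * (x + y))"
    by (simp add: algebra_simps)
  also have "\<dots> = (x + y) * y * (real k + 1) + (z * (real n + 1) + (real n + 1) * x) * x"
    by (simp only: absorb1) (simp add: algebra_simps)
  also have "\<dots> = (x + y) * y * (real k + 1) + (2 * real n + 2 - real k) * z * x"
    by (simp only: absorb2[symmetric]) (simp add: algebra_simps)
  finally have key: "(z + x + y) * (x + y) * (real k + 1)
      = (x + y) * y * (real k + 1) + (2 * real n + 2 - real k) * z * x" .
  have "real (a_coeff (Suc i) (Suc k)) = (z + x + y) * (x + y) * (real k + 1) * fact k"
    by (simp add: a_coeff_def Suc x_def y_def z_def algebra_simps)
  also have "\<dots> = (x + y) * y * (real k + 1) * fact k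
      + (2 * real n + 2 - real k) * (z * x * fact k)"
    unfolding key by (simp add: algebra_simps)
  also have "(x + y) * y * (real k + 1) * fact k = real (a_coeff i (Suc k))"
    by (simp add: a_coeff_def Suc x_def y_def algebra_simps)
  also have "z * x * fact k = real (a_coeff i k)"
    by (simp add: a_coeff_def Suc x_def z_def)
  finally show ?thesis by (simp add: Suc algebra_simps)
qed

text \<open>
  The polynomial \<open>P\<^sub>i\<close>. The summation runs to \<open>i\<close> rather than \<open>i - 1\<close>, which covers \<open>i = 0\<close>
  with \<open>P\<^sub>0 = 1\<close>; the additional coefficient vanishes for \<open>i \<ge> 1\<close>.
\<close>
definition deriv_poly :: "nat \<Rightarrow> real \<Rightarrow> real" where
  "deriv_poly i t = (\<Sum>k\<le>i. (- 1) ^ k * real (a_coeff i k) * t ^ k)"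

lemma deriv_poly_conv:
  assumes "i \<ge> 1"
  shows "deriv_poly i t = (\<Sum>k = 0..i - 1. (- 1) ^ k * real (a_coeff i k) * t ^ k)"
proof -
  obtain n where "i = Suc n" using assms by (cases i) auto
  then show ?thesis
    by (simp add: deriv_poly_def a_coeff_def atLeast0AtMost)
qed

lemma deriv_poly_has_derivative:
  "(deriv_poly i has_real_derivative
     (\<Sum>k\<le>i. (- 1) ^ k * real (a_coeff i k) * (real k * t ^ (k - 1)))) (at t)"
  unfolding deriv_poly_def
  by (auto intro!: derivative_eq_intros sum.cong)

lemma deriv_poly_Suc:
  "deriv_poly (Suc i) t = deriv_poly i t - 2 * real i * t * deriv_poly i t
     + t ^ 2 * (\<Sum>k\<le>i. (- 1) ^ k * real (a_coeff i k) * (real k * t ^ (k - 1)))"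
proof -
  let ?c = "\<lambda>k. (- 1) ^ k * real (a_coeff i k)"
  \<comment> \<open>At \<open>k = 0\<close> the truncated exponent \<open>k - 1\<close> is harmless, since the factor \<open>k\<close> vanishes.\<close>
  have lower: "t ^ 2 * (real k * t ^ (k - 1)) = real k * t ^ Suc k" for k
    by (cases k) (simp_all add: power2_eq_square)
  have "deriv_poly i t = (\<Sum>k\<le>Suc i. ?c k * t ^ k)"
    by (simp add: deriv_poly_def a_coeff_eq_0)
  also have "\<dots> = 1 + (\<Sum>k\<le>i. ?c (Suc k) * t ^ Suc k)"
    by (subst sum.atMost_Suc_shift) simp
  finally have shift: "deriv_poly i t = 1 + (\<Sum>k\<le>i. ?c (Suc k) * t ^ Suc k)" .
  have "deriv_poly (Suc i) t
      = 1 + (\<Sum>k\<le>i. (- 1) ^ Suc k * real (a_coeff (Suc i) (Suc k)) * t ^ Suc k)"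
    unfolding deriv_poly_def by (subst sum.atMost_Suc_shift) simp
  also have "\<dots> = 1 + (\<Sum>k\<le>i. ?c (Suc k) * t ^ Suc k
      - 2 * real i * t * (?c k * t ^ k) + ?c k * (real k * t ^ Suc k))"
    by (simp add: a_coeff_Suc_Suc algebra_simps)
  also have "\<dots> = deriv_poly i t - 2 * real i * t * (\<Sum>k\<le>i. ?c k * t ^ k)
      + (\<Sum>k\<le>i. ?c k * (real k * t ^ Suc k))"
    by (simp only: shift sum.distrib sum_subtractf sum_distrib_left add_diff_eq)
  also have "(\<Sum>k\<le>i. ?c k * (real k * t ^ Suc k))
      = t ^ 2 * (\<Sum>k\<le>i. ?c k * (real k * t ^ (k - 1)))"
    unfolding sum_distrib_left lower[symmetric] by (simp add: mult_ac)
  finally show ?thesis by (simp only: deriv_poly_def)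
qed

lemma exp_deriv_poly_has_derivative:
  assumes "t \<noteq> 0"
  shows "((\<lambda>s. exp (- 1 / s) / s ^ (2 * i) * deriv_poly i s) has_real_derivative
           exp (- 1 / t) / t ^ (2 * Suc i) * deriv_poly (Suc i) t) (at t)"
proof -
  define E where "E = exp (- 1 / t)"
  have pow: "real (2 * i) * t ^ (2 * i - Suc 0) = real (2 * i) * t ^ (2 * i) / t"
    using assms by (cases i) simp_all
  have "((\<lambda>s. exp (- 1 / s)) has_real_derivative E / t ^ 2) (at t)"
    using assms by (auto intro!: derivative_eq_intros simp: E_def power2_eq_square)
  moreover have "((\<lambda>s. s ^ (2 * i)) has_real_derivative real (2 * i) * t ^ (2 * i) / t) (at t)"
    unfolding pow[symmetric] by (rule DERIV_pow)
  ultimately have "((\<lambda>s. exp (- 1 / s) / s ^ (2 * i)) has_real_derivative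
      (E / t ^ 2 * t ^ (2 * i) - E * (real (2 * i) * t ^ (2 * i) / t))
        / (t ^ (2 * i) * t ^ (2 * i))) (at t)"
    using assms unfolding E_def by (intro DERIV_divide) auto
  from DERIV_mult[OF this deriv_poly_has_derivative[of i t]]
  show ?thesis
    unfolding deriv_poly_Suc E_def[symmetric]
    by (rule DERIV_cong) (use assms in \<open>simp add: E_def[symmetric] field_simps power2_eq_square\<close>)
qed

lemma has_real_derivative_transform_nonzero:
  fixes f h :: "real \<Rightarrow> real"
  assumes "(f has_real_derivative D) (at t)" "t \<noteq> 0" "\<And>s. s \<noteq> 0 \<Longrightarrow> f s = h s"
  shows "(h has_real_derivative D) (at t)"
  using assms by (intro has_field_derivative_transform_within_open[of f D t "- {0}" h]) auto

lemma higher_deriv_exp_minus_inverse: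
  fixes g :: "real \<Rightarrow> real"
  assumes g: "\<And>s. s \<noteq> 0 \<Longrightarrow> g s = exp (- 1 / s)" and "t \<noteq> 0"
  shows "(deriv ^^ i) g t = exp (- 1 / t) / t ^ (2 * i) * deriv_poly i t"
  using \<open>t \<noteq> 0\<close>
proof (induction i arbitrary: t)
  case 0
  then show ?case by (simp add: g deriv_poly_def)
next
  case (Suc i)
  have "((deriv ^^ i) g has_real_derivative
      exp (- 1 / t) / t ^ (2 * Suc i) * deriv_poly (Suc i) t) (at t)"
    using exp_deriv_poly_has_derivative[OF Suc.prems] Suc.prems
    by (rule has_real_derivative_transform_nonzero) (simp add: Suc.IH)
  then show ?case by (simp only: funpow.simps o_apply DERIV_imp_deriv)
qed

(* The value of g at 0 is left unspecified.  Since deriv is a total operator, the first conjunct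
   records that the i-th derivative really exists at t. *)
theorem theorem2:
  fixes g :: "real \<Rightarrow> real" and i :: nat and t :: real
  assumes g: "\<And>s. s \<noteq> 0 \<Longrightarrow> g s = exp (- 1 / s)"
    and i: "i \<ge> 1"
    and t: "t \<noteq> 0"
  shows "(deriv ^^ (i - 1)) g field_differentiable (at t) \<and>
    (deriv ^^ i) g t =
      1 / (exp (1 / t) * t ^ (2 * i)) * (\<Sum>k = 0..i - 1. (- 1) ^ k * real (a_coeff i k) * t ^ k)"
proof
  show "(deriv ^^ (i - 1)) g field_differentiable (at t)"
    unfolding field_differentiable_def
    using has_real_derivative_transform_nonzero[OF exp_deriv_poly_has_derivative[OF t] t]
      higher_deriv_exp_minus_inverse[OF g] by metis
  have "exp (- 1 / t) = 1 / exp (1 / t)"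
    by (simp add: exp_minus inverse_eq_divide)
  then show "(deriv ^^ i) g t =
      1 / (exp (1 / t) * t ^ (2 * i)) * (\<Sum>k = 0..i - 1. (- 1) ^ k * real (a_coeff i k) * t ^ k)"
    using higher_deriv_exp_minus_inverse[OF g t, of i] deriv_poly_conv[OF i, of t] by simp
qed

end
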